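(* Let $k \ge 2$ be an integer and let $G^L(k) = (C \cup (V\setminus C), E)$ be any graph with vertex set $V$ and $C\subseteq V$ such that $|C| = k$ and $V \setminus C$ consists of exactly one vertex $v_{C'}$ with $N(v_{C'}) \cap C = C'$ for each non-empty subset $C' \subseteq C$ (with no condition on the edges inside $C$ or inside $V\setminus C$). Then in $G^L(k)$, the set $C$ is a minimum-cardinality (i) LD-code; (ii) LTD-code if $G^L(k)[C]$ has no isolated vertex, that is, if $G^L(k)[C]$ is LTD-admissible. Moreover, for $X \in \{\mathrm{LD}, \mathrm{LTD}\}$, the minimum X-density among all X-admissible graphs with X-number $k$ is attained by any graph $G^L(k)$ if $X=\mathrm{LD}$, and by those graphs $G^L(k)$ for which $G^L(k)[C]$ has no isolated vertex if $X=\mathrm{LTD}$.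
   Context: Graphs are finite, simple and undirected. For a graph $G=(V,E)$ and $v\in V$, $N(v)$ is the open neighborhood and $N[v]=N(v)\cup\{v\}$ the closed neighborhood; $G[C]$ is the subgraph induced by $C$. A set $C\subseteq V$ is dominating (resp. total-dominating) if $N[v]\cap C\neq\emptyset$ (resp. $N(v)\cap C\ne\emptyset$) for all $v\in V$. A set $C$ is location-separating if $N(u)\cap C\neq N(v)\cap C$ for all distinct $u,v\in V\setminus C$. An LD-code (resp. LTD-code) is a set that is location-separating and dominating (resp. total-dominating). A graph is X-admissible if it has an X-code; the X-number $\gamma^{X}(G)$ of an X-admissible graph is the minimum cardinality of an X-code of $G$. The X-density of an X-admissible graph $G$ on $n$ vertices is $\gamma^{X}(G)/n$. *)

theory Defs
  imports Complex_Main "Graph_Theory.Graph_Theory"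
begin

text \<open>
  Finite simple undirected graphs are taken from the library locale \<^locale>\<open>graph\<close>: finite
  symmetric digraphs without loops and parallel arcs, an edge \<open>uv\<close> being the pair of opposite arcs
  between \<open>u\<close> and \<open>v\<close>. Induced subgraphs are \<open>G \<restriction> C\<close>.
\<close>

definition nbhd :: "('a, 'b) pre_digraph \<Rightarrow> 'a \<Rightarrow> 'a set" where
  "nbhd G v = {u \<in> verts G. v \<rightarrow>\<^bsub>G\<^esub> u}"

definition closed_nbhd :: "('a, 'b) pre_digraph \<Rightarrow> 'a \<Rightarrow> 'a set" where
  "closed_nbhd G v = insert v (nbhd G v)"

definition dominating :: "('a, 'b) pre_digraph \<Rightarrow> 'a set \<Rightarrow> bool" where
  "dominating G C \<longleftrightarrow> C \<subseteq> verts G \<and> (\<forall>v \<in> verts G. closed_nbhd G v \<inter> C \<noteq> {})"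

definition total_dominating :: "('a, 'b) pre_digraph \<Rightarrow> 'a set \<Rightarrow> bool" where
  "total_dominating G C \<longleftrightarrow> C \<subseteq> verts G \<and> (\<forall>v \<in> verts G. nbhd G v \<inter> C \<noteq> {})"

definition location_separating :: "('a, 'b) pre_digraph \<Rightarrow> 'a set \<Rightarrow> bool" where
  "location_separating G C \<longleftrightarrow> C \<subseteq> verts G \<and>
     (\<forall>u \<in> verts G - C. \<forall>v \<in> verts G - C. u \<noteq> v \<longrightarrow> nbhd G u \<inter> C \<noteq> nbhd G v \<inter> C)"

datatype code_kind = LD | LTD

fun is_code :: "code_kind \<Rightarrow> ('a, 'b) pre_digraph \<Rightarrow> 'a set \<Rightarrow> bool" where
  "is_code LD G C \<longleftrightarrow> location_separating G C \<and> dominating G C"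
| "is_code LTD G C \<longleftrightarrow> location_separating G C \<and> total_dominating G C"

definition admissible :: "code_kind \<Rightarrow> ('a, 'b) pre_digraph \<Rightarrow> bool" where
  "admissible X G \<longleftrightarrow> (\<exists>C. is_code X G C)"

text \<open>The \<open>X\<close>-number and the \<open>X\<close>-density are meaningful for \<open>X\<close>-admissible graphs only.\<close>

definition code_number :: "code_kind \<Rightarrow> ('a, 'b) pre_digraph \<Rightarrow> nat" where
  "code_number X G = (LEAST m. \<exists>C. is_code X G C \<and> card C = m)"

definition minimum_code :: "code_kind \<Rightarrow> ('a, 'b) pre_digraph \<Rightarrow> 'a set \<Rightarrow> bool" where
  "minimum_code X G C \<longleftrightarrow> is_arg_min card (is_code X G) C"

definition code_density :: "code_kind \<Rightarrow> ('a, 'b) pre_digraph \<Rightarrow> real" where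
  "code_density X G = real (code_number X G) / real (card (verts G))"

definition no_isolated_vertex :: "('a, 'b) pre_digraph \<Rightarrow> bool" where
  "no_isolated_vertex G \<longleftrightarrow> (\<forall>v \<in> verts G. nbhd G v \<noteq> {})"

text \<open>
  \<open>is_GL k G C\<close>: the graph \<open>G\<close>, with distinguished vertex set \<open>C\<close>, is a graph \<open>G\<^sup>L(k)\<close>. The
  bijection says that the vertices outside \<open>C\<close> are exactly one vertex \<open>v\<close> with \<open>N(v) \<inter> C = C'\<close> for
  each non-empty \<open>C' \<subseteq> C\<close>.
\<close>

definition is_GL :: "nat \<Rightarrow> ('a, 'b) pre_digraph \<Rightarrow> 'a set \<Rightarrow> bool" where
  "is_GL k G C \<longleftrightarrow> graph G \<and> C \<subseteq> verts G \<and> card C = k \<and>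
     bij_betw (\<lambda>v. nbhd G v \<inter> C) (verts G - C) (Pow C - {{}})"

end

theory Submission
  imports Defs
begin

text \<open>
  A code \<open>D\<close> (of either kind) gives the vertices outside \<open>D\<close> distinct non-empty traces on \<open>D\<close>, so a
  graph with a code of size \<open>m\<close> has at most \<open>m + 2\<^sup>m - 1\<close> vertices. The graphs \<open>G\<^sup>L(k)\<close> attain this
  bound for \<open>m = k\<close>; as the bound is strictly increasing in \<open>m\<close>, they have no smaller code, and they
  have the most vertices among the graphs with the same X-number.
\<close>

lemma is_code_subset: "is_code X G D \<Longrightarrow> D \<subseteq> verts G"
  by (cases X) (auto simp: location_separating_def)

lemma is_code_trace_inj_on:
  "is_code X G D \<Longrightarrow> inj_on (\<lambda>v. nbhd G v \<inter> D) (verts G - D)"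
  by (cases X) (fastforce simp: location_separating_def inj_on_def)+

text \<open>This is where the two kinds of code meet: a vertex outside \<open>D\<close> cannot
  dominate itself, so even ordinary domination must come from a neighbour in
  \<open>D\<close>.\<close>

lemma is_code_trace_nonempty:
  assumes "is_code X G D" "v \<in> verts G - D"
  shows "nbhd G v \<inter> D \<noteq> {}"
proof (cases X)
  case LD
  then have "closed_nbhd G v \<inter> D \<noteq> {}"
    using assms by (simp add: dominating_def)
  then show ?thesis
    using assms(2) by (auto simp: closed_nbhd_def)
next
  case LTD
  then show ?thesis
    using assms by (simp add: total_dominating_def)
qed

lemma card_Pow_minus_empty: "finite D \<Longrightarrow> card (Pow D - {{}}) = 2 ^ card D - 1"
  by (simp add: card_Pow card_Diff_singleton)

lemma card_verts_le:
  assumes "finite (verts G)" "is_code X G D"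
  shows "card (verts G) \<le> card D + (2 ^ card D - 1)"
proof -
  have sub: "D \<subseteq> verts G" and fin: "finite D"
    using is_code_subset[OF assms(2)] assms(1) finite_subset by auto
  have "card (verts G - D) \<le> card (Pow D - {{}})"
    using is_code_trace_nonempty[OF assms(2)] fin
    by (intro card_inj_on_le[OF is_code_trace_inj_on[OF assms(2)]]) auto
  then have "card (verts G - D) \<le> 2 ^ card D - 1"
    by (simp only: card_Pow_minus_empty[OF fin])
  then show ?thesis
    using card_Diff_subset[OF fin sub] by linarith
qed

lemma code_number_eq_card:
  assumes "minimum_code X G D"
  shows "code_number X G = card D"
  using assms unfolding minimum_code_def code_number_def is_arg_min_linorder
  by (intro Least_equality) auto

lemma minimum_code_admissible: "minimum_code X G D \<Longrightarrow> admissible X G"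
  by (auto simp: minimum_code_def is_arg_min_def admissible_def)

text \<open>Admissibility makes the set under \<open>LEAST\<close> non-empty; without it the value
  of \<open>code_number\<close> carries no information.\<close>

lemma code_number_attained:
  assumes "admissible X G"
  obtains D where "is_code X G D" "card D = code_number X G"
proof -
  have "\<exists>m D. is_code X G D \<and> card D = m"
    using assms by (auto simp: admissible_def)
  from LeastI_ex[OF this] show ?thesis
    using that unfolding code_number_def by blast
qed

text \<open>Conversely to the obvious direction, the whole vertex set serves as a code: it is
  vacuously location-separating, and it is total-dominating when every vertex has a
  neighbour.\<close>

lemma admissible_LTD_iff: "admissible LTD G \<longleftrightarrow> no_isolated_vertex G"
proof
  show "no_isolated_vertex G" if "admissible LTD G"
    using that by (auto simp: admissible_def total_dominating_def no_isolated_vertex_def)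
next
  assume "no_isolated_vertex G"
  then have "is_code LTD G (verts G)"
    by (auto simp: no_isolated_vertex_def location_separating_def total_dominating_def nbhd_def)
  then show "admissible LTD G"
    unfolding admissible_def ..
qed

text \<open>Translates the hypothesis on \<open>G \<restriction> C\<close> into total domination, by
  \<open>C\<close>, of the vertices of \<open>C\<close> itself.\<close>

lemma nbhd_induce_subgraph:
  assumes "C \<subseteq> verts G" "v \<in> C"
  shows "nbhd (G \<restriction> C) v = nbhd G v \<inter> C"
  using assms by (auto simp: nbhd_def induce_subgraph_def arcs_ends_def arc_to_ends_def)

lemma is_GL_finite: "is_GL k G C \<Longrightarrow> finite (verts G)"
  unfolding is_GL_def graph_def digraph_def fin_digraph_def fin_digraph_axioms_def by blast

lemma is_GL_card_verts:
  assumes "is_GL k G C"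
  shows "card (verts G) = k + (2 ^ k - 1)"
proof -
  have sub: "C \<subseteq> verts G" and k: "card C = k"
    and bij: "bij_betw (\<lambda>v. nbhd G v \<inter> C) (verts G - C) (Pow C - {{}})"
    using assms by (auto simp: is_GL_def)
  have fin: "finite C"
    using sub is_GL_finite[OF assms] by (rule finite_subset)
  have "card (verts G - C) = 2 ^ k - 1"
    using bij_betw_same_card[OF bij] card_Pow_minus_empty[OF fin] k by simp
  \<comment> \<open>Needed to undo the truncated subtraction
    \<open>card (verts G) - card C\<close>.\<close>
  moreover have "card C \<le> card (verts G)"
    using is_GL_finite[OF assms] sub by (rule card_mono)
  ultimately show ?thesis
    using card_Diff_subset[OF fin sub] k by linarith
qed

lemma is_GL_trace_nonempty:
  assumes "is_GL k G C" "v \<in> verts G - C"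
  shows "nbhd G v \<inter> C \<noteq> {}"
  using assms bij_betwE unfolding is_GL_def by fastforce

lemma is_GL_location_separating: "is_GL k G C \<Longrightarrow> location_separating G C"
  by (auto simp: is_GL_def location_separating_def bij_betw_def inj_on_def)

text \<open>Vertices of \<open>C\<close> lie in their own closed neighbourhoods, and the others have
  non-empty traces.\<close>

lemma is_GL_is_code_LD:
  assumes "is_GL k G C"
  shows "is_code LD G C"
  using is_GL_location_separating[OF assms] is_GL_trace_nonempty[OF assms] assms
  by (auto simp: is_GL_def dominating_def closed_nbhd_def)

lemma is_GL_is_code_LTD:
  assumes "is_GL k G C" "no_isolated_vertex (G \<restriction> C)"
  shows "is_code LTD G C"
proof -
  have sub: "C \<subseteq> verts G"
    using assms(1) by (simp add: is_GL_def)
  have "nbhd G v \<inter> C \<noteq> {}" if "v \<in> verts G" for v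
  proof (cases "v \<in> C")
    case True
    then show ?thesis
      using assms(2) nbhd_induce_subgraph[OF sub True] by (auto simp: no_isolated_vertex_def)
  next
    case False
    then show ?thesis
      using that is_GL_trace_nonempty[OF assms(1)] by blast
  qed
  then show ?thesis
    using is_GL_location_separating[OF assms(1)] sub by (simp add: total_dominating_def)
qed

lemma is_GL_minimum_code:
  assumes "is_GL k G C" "is_code X G C"
  shows "minimum_code X G C"
proof -
  have "k \<le> card D" if D: "is_code X G D" for D
  proof (rule ccontr)
    assume less: "\<not> k \<le> card D"
    \<comment> \<open>Weak monotonicity of the power suffices: in \<open>m + (2 ^ m - 1)\<close> the
      summand \<open>m\<close> already gives the strict increase.\<close>
    then have "(2::nat) ^ card D \<le> 2 ^ k"
      by (intro power_increasing) auto
    then show False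
      using card_verts_le[OF is_GL_finite[OF assms(1)] D] is_GL_card_verts[OF assms(1)] less
      by linarith
  qed
  then show ?thesis
    using assms by (auto simp: minimum_code_def is_arg_min_linorder is_GL_def)
qed

text \<open>Both densities have numerator \<open>k\<close>, so the graph with more vertices has the
  smaller or equal density.\<close>

lemma is_GL_code_density_le:
  assumes "is_GL k G C" "is_code X G C" "k > 0"
    and H: "finite (verts H)" "admissible X H" "code_number X H = k"
  shows "code_density X G \<le> code_density X H"
proof -
  obtain D where D: "is_code X H D" "card D = k"
    using code_number_attained H(2,3) by metis
  have "card (verts H) \<le> card (verts G)"
    using card_verts_le[OF H(1) D(1)] D(2) is_GL_card_verts[OF assms(1)] by simp
  \<comment> \<open>Comparing the fractions requires a positive smaller denominator; it is at least
    \<open>k\<close>, since \<open>H\<close> contains a code of that size.\<close>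
  moreover have "card (verts H) > 0"
    using card_mono[OF H(1) is_code_subset[OF D(1)]] D(2) \<open>k > 0\<close> by linarith
  moreover have "code_number X G = k"
    using code_number_eq_card[OF is_GL_minimum_code[OF assms(1,2)]] assms(1)
    by (simp add: is_GL_def)
  ultimately show ?thesis
    using H(3) by (simp add: code_density_def frac_le)
qed

text \<open>The competitors \<open>H\<close> have their own vertex and arc types, so the minimum is
  not confined to graphs over the types of \<open>G\<close>.\<close>

lemma is_GL_optimal:
  assumes "is_GL k G C" "is_code X G C" "k > 0"
  shows "admissible X G \<and> code_number X G = k \<and>
    (\<forall>H :: ('c, 'd) pre_digraph.
       graph H \<and> admissible X H \<and> code_number X H = k \<longrightarrow>
       code_density X G \<le> code_density X H)"
proof (intro conjI allI impI)
  note min = is_GL_minimum_code[OF assms(1,2)]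
  show "admissible X G"
    using min by (rule minimum_code_admissible)
  show "code_number X G = k"
    using code_number_eq_card[OF min] assms(1) by (simp add: is_GL_def)
  fix H :: "('c, 'd) pre_digraph"
  assume H: "graph H \<and> admissible X H \<and> code_number X H = k"
  then have "finite (verts H)"
    unfolding graph_def digraph_def fin_digraph_def fin_digraph_axioms_def by blast
  then show "code_density X G \<le> code_density X H"
    using is_GL_code_density_le[OF assms] H by blast
qed

theorem theorem1:
  fixes G :: "('a, 'b) pre_digraph" and C :: "'a set" and k :: nat
  assumes "k \<ge> 2"
    and "is_GL k G C"
  shows "minimum_code LD G C \<and>
    (no_isolated_vertex (G \<restriction> C) \<longleftrightarrow> admissible LTD (G \<restriction> C)) \<and>
    (no_isolated_vertex (G \<restriction> C) \<longrightarrow> minimum_code LTD G C) \<and>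
    (admissible LD G \<and> code_number LD G = k \<and>
      (\<forall>H :: ('c, 'd) pre_digraph.
         graph H \<and> admissible LD H \<and> code_number LD H = k \<longrightarrow>
         code_density LD G \<le> code_density LD H)) \<and>
    (no_isolated_vertex (G \<restriction> C) \<longrightarrow>
      admissible LTD G \<and> code_number LTD G = k \<and>
      (\<forall>H :: ('c, 'd) pre_digraph.
         graph H \<and> admissible LTD H \<and> code_number LTD H = k \<longrightarrow>
         code_density LTD G \<le> code_density LTD H))"
proof -
  have "k > 0"
    using assms(1) by simp
  note LD = is_GL_is_code_LD[OF assms(2)]
  note LTD = is_GL_is_code_LTD[OF assms(2)]
  show ?thesis
    using is_GL_minimum_code[OF assms(2) LD] is_GL_optimal[OF assms(2) LD \<open>k > 0\<close>]
      is_GL_minimum_code[OF assms(2) LTD] is_GL_optimal[OF assms(2) LTD \<open>k > 0\<close>]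
      admissible_LTD_iff[of "G \<restriction> C"]
    by (intro conjI impI) blast+
qed

end
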